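(* Let $(Z_k)_{k\in\mathbb N}$ be independent with $Z_k\sim N(\mu_k,1)$, $\mu_k\ge0$, $r_k=\mathbf 1(\mu_k>0)$, $p_k=1-\Phi(Z_k)$. Let $\alpha,\beta\in(0,1)$ with $\alpha\le(1-\beta)/4$, and let $(\alpha_k)_{k\ge1}$ be nonnegative with $\sum_{k=1}^\infty\alpha_k=\alpha$. The online Bonferroni test rejects iff there exists $k\in\mathbb N$ with $p_k\le\alpha_k$. (i) If $\sum_{k=1}^\infty r_k=\infty$, then a necessary condition for the online Bonferroni test to have power at least $1-\beta$ is that there exists $k\in\mathbb N$ with $r_k\mu_k\ge 0.25\big(\sqrt{2\log(k^2/\alpha)}\big)^{-1}$. (ii) If $\sum_{k=1}^\infty r_k\le M<\infty$ for a constant $M$, and $(\alpha_k)$ is nonincreasing, then the online Bonferroni test can have power at least $1-\beta$ only if there exists $k\in\mathbb N$ such that $r_k\mu_k\ge0.4\sqrt{\alpha_{k^*}}$ if $k\le k^*$, or $r_k\mu_k\ge\sqrt{\log\big(\frac{k}{4\alpha}\big)}-\sqrt{2\log\big(\frac{M}{2(1-\beta-3\alpha)}\big)}$ if $k>k^*$, where $k^*=M^2/\alpha$ and $\alpha_{k^*}$ is the $k^*$-th significance level. (iii) A sufficient condition for the online martingale Stouffer test at level $\alpha$, which rejects iff there exists $k\in\mathbb N$ with $\sum_{i=1}^k\Phi^{-1}(1-p_i)\ge C_k^\alpha k^{1/2}$, to have power at least $1-\beta$ is that there exists $k\in\mathbb N$ with $\sum_{i=1}^k\mu_ir_i\ge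(C_k^\alpha+C_k^\beta)k^{1/2}$.
   Context: $\Phi$ is the standard Gaussian CDF. For $\gamma\in(0,1)$ and $k\ge1$, $C_k^\gamma=1.7\sqrt{\log\log(2k)+0.72\log\frac{5.2}{\gamma}}$. The power of a test is the probability that it rejects. *)

theory Defs
  imports "HOL-Probability.Probability"
begin

definition Phi :: "real \<Rightarrow> real" where
  "Phi x = measure (density lborel std_normal_density) {..x}"

definition Phi_inv :: "real \<Rightarrow> real" where
  "Phi_inv y = (THE x. Phi x = y)"

definition Ck :: "nat \<Rightarrow> real \<Rightarrow> real" where
  "Ck k \<gamma> = 1.7 * sqrt (ln (ln (2 * real k)) + 0.72 * ln (5.2 / \<gamma>))"

definition pval :: "(nat \<Rightarrow> 'a \<Rightarrow> real) \<Rightarrow> nat \<Rightarrow> 'a \<Rightarrow> real" where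
  "pval Z k \<omega> = 1 - Phi (Z k \<omega>)"

definition bonferroni_rejects :: "(nat \<Rightarrow> real) \<Rightarrow> (nat \<Rightarrow> 'a \<Rightarrow> real) \<Rightarrow> 'a \<Rightarrow> bool" where
  "bonferroni_rejects a Z \<omega> \<longleftrightarrow> (\<exists>k\<ge>1. pval Z k \<omega> \<le> a k)"

definition stouffer_rejects :: "real \<Rightarrow> (nat \<Rightarrow> 'a \<Rightarrow> real) \<Rightarrow> 'a \<Rightarrow> bool" where
  "stouffer_rejects \<alpha> Z \<omega> \<longleftrightarrow>
     (\<exists>k\<ge>1. (\<Sum>i=1..k. Phi_inv (1 - pval Z i \<omega>)) \<ge> Ck k \<alpha> * sqrt (real k))"

definition power :: "'a measure \<Rightarrow> ('a \<Rightarrow> bool) \<Rightarrow> real" where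
  "power P T = measure P {\<omega> \<in> space P. T \<omega>}"

definition rind :: "(nat \<Rightarrow> real) \<Rightarrow> nat \<Rightarrow> real" where
  "rind \<mu> k = (if \<mu> k > 0 then 1 else 0)"

end

theory Submission
  imports Defs "HOL-Real_Asymp.Real_Asymp"
begin

text \<open>Parts (i) and (ii) use only the union bound over the events \<open>p\<^sub>k \<le> a\<^sub>k\<close>. The estimate
  \<open>\<phi> t \<le> (1 + t) (1 - \<Phi> t)\<close> for \<open>t \<ge> 0\<close> bounds the hazard rate of the Gaussian, so shifting
  the mean by \<open>m\<close> multiplies a rejection probability \<open>b\<close> by at most
  \<open>exp (m (1 + sqrt (2 ln (1 / b))))\<close>. In (i), \<open>a\<^sub>k\<close> is replaced by
  \<open>max a\<^sub>k (\<alpha> / k\<^sup>2)\<close>, so the levels sum to at most \<open>(1 + pi\<^sup>2 / 6) \<alpha>\<close> and the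
  factor stays below \<open>exp (7 / 17)\<close>. In (ii) the factor is at most \<open>19 / 10\<close> for the early
  hypotheses, while a late one has \<open>a\<^sub>k \<le> \<alpha> / k\<close> by monotonicity, hence a quantile of at least
  \<open>sqrt (ln (k / (4 \<alpha>)))\<close>. Part (iii) is a Gaussian tail bound for the partial sum at the given
  \<open>k\<close>.\<close>

section \<open>Calculus of the standard Gaussian CDF: derivative, monotonicity, inverse,
  symmetry\<close>

abbreviation gauss_tail :: "real \<Rightarrow> real" where
  "gauss_tail x \<equiv> 1 - Phi x"

lemma Phi_eq_cdf: "Phi = cdf std_normal_distribution"
  by (simp add: Phi_def cdf_def fun_eq_iff)

interpretation std_normal: real_distribution std_normal_distribution
  by (rule real_dist_normal_dist)

text \<open>Near \<open>x\<close>, \<open>Phi\<close> differs by the constant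
  \<open>Phi (x - 1)\<close> from an integral over a compact interval, to which the fundamental
  theorem of calculus applies.\<close>

lemma Phi_has_real_derivative [derivative_intros]:
  "(Phi has_real_derivative std_normal_density x) (at x)"
proof -
  define F where "F = (\<lambda>u. integral {x - 1..u} std_normal_density)"
  have eq: "Phi u = Phi (x - 1) + F u" if "u \<in> {x - 1<..<x + 1}" for u
  proof -
    have "Phi u - Phi (x - 1) = measure std_normal_distribution {x - 1<..u}"
      using std_normal.cdf_diff_eq[of "x - 1" u] that by (simp add: Phi_eq_cdf)
    also have "\<dots> = (LINT t|std_normal_distribution. indicator {x - 1<..u} t)"
      by simp
    also have "\<dots> = (LINT t:{x - 1<..u}|lborel. std_normal_density t)"
      unfolding set_lebesgue_integral_def
      by (subst integral_density) (auto simp: mult.commute)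
    also have "\<dots> = (LINT t:{x - 1..u}|lborel. std_normal_density t)"
      unfolding set_lebesgue_integral_def
      by (intro integral_cong_AE AE_I[where N = "{x - 1}"])
        (auto simp: indicator_def split: if_splits)
    also have "\<dots> = F u"
      unfolding F_def
      by (intro set_borel_integral_eq_integral(2), unfold set_integrable_def)
        (rule integrable_mult_indicator, auto)
    finally show ?thesis by simp
  qed
  have "(F has_real_derivative std_normal_density x) (at x within {x - 1..x + 1})"
    unfolding F_def
    by (intro integral_has_real_derivative)
      (auto simp: std_normal_density_def intro!: continuous_intros)
  then have "(F has_real_derivative std_normal_density x) (at x)"
    by (subst (asm) at_within_interior) auto
  then have "((\<lambda>u. Phi (x - 1) + F u) has_real_derivative std_normal_density x) (at x)"
    by (auto intro!: derivative_eq_intros)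
  then show ?thesis
    by (rule has_field_derivative_transform_within_open[where S = "{x - 1<..<x + 1}"])
      (auto simp: eq)
qed

lemma Phi_strict_mono: "x < y \<Longrightarrow> Phi x < Phi y"
  by (rule DERIV_pos_imp_increasing[of x y Phi])
    (use Phi_has_real_derivative normal_density_pos zero_less_one in blast)+

lemma Phi_less_iff [simp]: "Phi x < Phi y \<longleftrightarrow> x < y"
  using Phi_strict_mono[of x y] Phi_strict_mono[of y x] by (cases x y rule: linorder_cases) auto

lemma Phi_le_iff [simp]: "Phi x \<le> Phi y \<longleftrightarrow> x \<le> y"
  by (simp flip: not_less)

lemma Phi_eq_iff [simp]: "Phi x = Phi y \<longleftrightarrow> x = y"
  by (auto simp: order_eq_iff)

text \<open>Injectivity makes the definite description unique. Hence each summand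
  \<open>Phi_inv (1 - pval Z i \<omega>)\<close> of the Stouffer statistic is
  \<open>Z i \<omega>\<close> itself.\<close>

lemma Phi_inv_Phi [simp]: "Phi_inv (Phi x) = x"
  unfolding Phi_inv_def by (rule the_equality) auto

lemma Phi_tendsto_at_top: "(Phi \<longlongrightarrow> 1) at_top"
  unfolding Phi_eq_cdf by (rule std_normal.cdf_lim_at_top_prob)

lemma Phi_tendsto_at_bot: "(Phi \<longlongrightarrow> 0) at_bot"
  unfolding Phi_eq_cdf by (rule std_normal.cdf_lim_at_bot)

lemma Phi_less_1: "Phi x < 1"
  using Phi_strict_mono[of x "x + 1"] std_normal.cdf_bounded_prob[of "x + 1"]
  by (simp add: Phi_eq_cdf)

lemma continuous_on_Phi [continuous_intros]: "continuous_on S Phi"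
  by (rule DERIV_continuous_on) (rule has_field_derivative_at_within, rule Phi_has_real_derivative)

lemma isCont_Phi: "isCont Phi x"
  by (rule DERIV_isCont) (rule Phi_has_real_derivative)

lemma Phi_surj:
  assumes "0 < b" "b < 1"
  obtains z where "Phi z = b"
proof -
  obtain l where l: "Phi l < b"
    using order_tendstoD(2)[OF Phi_tendsto_at_bot assms(1)]
    by (auto dest: eventually_happens)
  obtain u where u: "b < Phi u"
    using order_tendstoD(1)[OF Phi_tendsto_at_top assms(2)]
    by (auto dest: eventually_happens)
  have "l < u" using l u Phi_less_iff by (meson less_trans)
  then show ?thesis
    using IVT[of Phi l b u] l u that isCont_Phi by auto
qed

text \<open>The density is even, so \<open>Phi x + Phi (- x)\<close> has derivative zero; its limit
  at infinity identifies the constant as 1.\<close>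

lemma Phi_minus: "Phi (- x) = 1 - Phi x"
proof -
  have der: "((\<lambda>x. Phi x + Phi (- x)) has_real_derivative 0) (at t)" for t
    by (auto intro!: derivative_eq_intros Phi_has_real_derivative DERIV_chain2[where f = Phi]
        simp: std_normal_density_def)
  have const: "Phi t + Phi (- t) = Phi x + Phi (- x)" for t
    by (rule DERIV_isconst_all) (auto intro: der)
  have "((\<lambda>t. Phi t + Phi (- t)) \<longlongrightarrow> 1 + 0) at_top"
    by (intro tendsto_add Phi_tendsto_at_top filterlim_compose[OF Phi_tendsto_at_bot]
        filterlim_uminus_at_bot_at_top)
  then have "((\<lambda>t::real. Phi x + Phi (- x)) \<longlongrightarrow> 1 + 0) at_top"
    by (subst (asm) const)
  then show ?thesis
    by (simp add: tendsto_const_iff)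
qed

lemma Phi_0 [simp]: "Phi 0 = 1 / 2"
  using Phi_minus[of 0] by simp

section \<open>Bounds for the Gaussian density, hazard rate and tail\<close>

lemma std_normal_density_le: "std_normal_density x \<le> 2/5"
proof -
  have "(5/2)\<^sup>2 \<le> 2 * pi"
    using pi_approx by (simp add: power2_eq_square)
  then have "5/2 \<le> sqrt (2 * pi)"
    by (rule real_le_rsqrt)
  then have "1 / sqrt (2 * pi) \<le> 2/5"
    by (simp add: field_simps)
  moreover have "exp (- x\<^sup>2 / 2) \<le> 1" by simp
  ultimately have "1 / sqrt (2 * pi) * exp (- x\<^sup>2 / 2) \<le> 2/5 * 1"
    by (intro mult_mono) auto
  then show ?thesis by (simp add: std_normal_density_def)
qed

lemma std_normal_density_derivative:
  "(std_normal_density has_real_derivative - x * std_normal_density x) (at x)"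
  unfolding std_normal_density_def[abs_def]
  by (auto intro!: derivative_eq_intros simp: field_simps)

lemma std_normal_density_tendsto_at_top: "(std_normal_density \<longlongrightarrow> 0) at_top"
  unfolding std_normal_density_def[abs_def] by real_asymp

text \<open>The difference of the tail and \<open>std_normal_density x / (1 + x)\<close> tends to 0
  at infinity and is strictly decreasing for positive \<open>x\<close>, hence positive there. Its
  derivative vanishes at 0, so \<open>t = 0\<close> is settled separately by 2/5 < 1/2.\<close>

lemma mills_ratio_lower:
  assumes "0 \<le> t"
  shows "std_normal_density t \<le> (1 + t) * gauss_tail t"
proof (cases "t = 0")
  case True
  then show ?thesis using std_normal_density_le[of 0] by simp
next
  case False
  with assms have t: "0 < t" by simp
  have lim: "((\<lambda>x. gauss_tail x - std_normal_density x * inverse (1 + x)) \<longlongrightarrow> (1 - 1) - 0 * 0) at_top"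
    by (intro tendsto_diff tendsto_mult tendsto_const Phi_tendsto_at_top
        std_normal_density_tendsto_at_top) real_asymp
  have "(1 - 1) - 0 * 0 < gauss_tail t - std_normal_density t * inverse (1 + t)"
  proof (rule DERIV_neg_imp_decreasing_at_top[OF _ lim])
    fix x assume x: "t \<le> x"
    then have pos: "0 < x" using t by simp
    have "((\<lambda>x. inverse (1 + x)) has_real_derivative - 1 / (1 + x)\<^sup>2) (at x)"
      using pos by (auto intro!: derivative_eq_intros simp: field_simps power2_eq_square)
    then have "((\<lambda>x. gauss_tail x - std_normal_density x * inverse (1 + x)) has_real_derivative
        - std_normal_density x * x / (1 + x)\<^sup>2) (at x)"
      using pos
      by (intro DERIV_cong[OF DERIV_diff[OF DERIV_diff[OF DERIV_const Phi_has_real_derivative]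
              DERIV_mult[OF std_normal_density_derivative]]])
        (auto simp: divide_simps, simp add: algebra_simps power2_eq_square)
    moreover have "- std_normal_density x * x / (1 + x)\<^sup>2 < 0"
      using pos normal_density_pos[of 1 0 x] by (simp add: divide_simps)
    ultimately show "\<exists>y. ((\<lambda>x. gauss_tail x - std_normal_density x * inverse (1 + x)) has_real_derivative y) (at x) \<and> y < 0"
      by blast
  qed
  then show ?thesis using t by (simp add: field_simps)
qed

text \<open>For negative \<open>t\<close> the tail is at least 1/2 and the density at most 2/5. This
  range matters because shifting the mean may push the argument below zero.\<close>

lemma hazard_le:
  assumes "t \<le> s" "0 \<le> s"
  shows "std_normal_density t \<le> (1 + s) * gauss_tail t"
proof (cases "0 \<le> t")
  case True
  then have "std_normal_density t \<le> (1 + t) * gauss_tail t" by (rule mills_ratio_lower)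
  also have "\<dots> \<le> (1 + s) * gauss_tail t"
    using assms Phi_less_1[of t] by (intro mult_right_mono) auto
  finally show ?thesis .
next
  case False
  have "Phi t \<le> Phi 0" using False by (simp del: Phi_0)
  then have "2/5 \<le> 1 * gauss_tail t" by simp
  also have "\<dots> \<le> (1 + s) * gauss_tail t"
    using assms Phi_less_1[of t] by (intro mult_right_mono) auto
  finally show ?thesis using std_normal_density_le[of t] by linarith
qed

text \<open>The hazard rate is at most \<open>1 + s\<close> up to \<open>z\<close>, so
  \<open>gauss_tail x * exp ((1 + s) * x)\<close> is nondecreasing there; compare its values at
  \<open>z - m\<close> and \<open>z\<close>.\<close>

lemma gauss_tail_shift_le:
  assumes "z \<le> s" "0 \<le> s" "0 \<le> m"
  shows "gauss_tail (z - m) \<le> exp (m * (1 + s)) * gauss_tail z"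
proof -
  have "gauss_tail (z - m) * exp ((1 + s) * (z - m)) \<le> gauss_tail z * exp ((1 + s) * z)"
  proof (rule DERIV_nonneg_imp_nondecreasing[where f = "\<lambda>x. gauss_tail x * exp ((1 + s) * x)"])
    fix x assume "x \<le> z"
    then have "std_normal_density x \<le> (1 + s) * gauss_tail x"
      using assms by (intro hazard_le) auto
    then have "0 \<le> exp ((1 + s) * x) * ((1 + s) * gauss_tail x - std_normal_density x)"
      by simp
    moreover have "((\<lambda>x. gauss_tail x * exp ((1 + s) * x)) has_real_derivative
        exp ((1 + s) * x) * ((1 + s) * gauss_tail x - std_normal_density x)) (at x)"
      by (auto intro!: derivative_eq_intros Phi_has_real_derivative simp: algebra_simps)
    ultimately show "\<exists>y. ((\<lambda>x. gauss_tail x * exp ((1 + s) * x)) has_real_derivative y) (at x) \<and> 0 \<le> y"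
      by blast
  qed (use assms in simp)
  then have "gauss_tail (z - m) \<le> gauss_tail z * (exp ((1 + s) * z) / exp ((1 + s) * (z - m)))"
    by (simp add: field_simps)
  also have "exp ((1 + s) * z) / exp ((1 + s) * (z - m)) = exp (m * (1 + s))"
    by (simp flip: exp_diff) (simp add: algebra_simps)
  finally show ?thesis by (simp add: mult.commute)
qed

text \<open>The gap \<open>D\<close> vanishes at 0 and at infinity, and its derivative changes sign
  once, at \<open>c\<close>: it increases before \<open>c\<close> and decreases to 0
  afterwards.\<close>

lemma gauss_tail_le_exp:
  assumes "0 \<le> z"
  shows "gauss_tail z \<le> exp (- z\<^sup>2 / 2) / 2"
proof -
  define D where "D = (\<lambda>z. exp (- z\<^sup>2 / 2) / 2 - gauss_tail z)"
  define c where "c = 2 / sqrt (2 * pi)"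
  have der: "(D has_real_derivative exp (- x\<^sup>2 / 2) / 2 * (c - x)) (at x)" for x
    unfolding D_def c_def
    by (auto intro!: derivative_eq_intros Phi_has_real_derivative
        simp: std_normal_density_def algebra_simps)
  have "((\<lambda>z::real. exp (- z\<^sup>2 / 2) / 2) \<longlongrightarrow> 0) at_top" by real_asymp
  then have "(D \<longlongrightarrow> 0 - (1 - 1)) at_top"
    unfolding D_def by (intro tendsto_diff tendsto_const Phi_tendsto_at_top)
  then have lim: "(D \<longlongrightarrow> 0) at_top" by simp
  have "0 \<le> D z"
  proof (cases "z \<le> c")
    case True
    have "D 0 \<le> D z"
    proof (rule DERIV_nonneg_imp_nondecreasing[OF assms])
      fix x assume "x \<le> z"
      then have "0 \<le> exp (- x\<^sup>2 / 2) / 2 * (c - x)" using True by simp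
      then show "\<exists>y. (D has_real_derivative y) (at x) \<and> 0 \<le> y" using der by blast
    qed
    then show ?thesis by (simp add: D_def)
  next
    case False
    have "0 < D z"
    proof (rule DERIV_neg_imp_decreasing_at_top[OF _ lim])
      fix x assume "z \<le> x"
      then have "exp (- x\<^sup>2 / 2) / 2 * (c - x) < 0"
        using False by (intro mult_pos_neg) auto
      then show "\<exists>y. (D has_real_derivative y) (at x) \<and> y < 0" using der by blast
    qed
    then show ?thesis by simp
  qed
  then show ?thesis by (simp add: D_def)
qed

lemma gauss_tail_quantile_le:
  assumes "gauss_tail z = b" "0 < b" "b \<le> 1"
  shows "z \<le> sqrt (2 * ln (1 / b))"
proof (cases "0 \<le> z")
  case True
  have "b \<le> exp (- z\<^sup>2 / 2) / 2" using gauss_tail_le_exp[OF True] assms by simp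
  also have "\<dots> \<le> exp (- z\<^sup>2 / 2)" by simp
  finally have "ln b \<le> - z\<^sup>2 / 2" using assms ln_mono[of b "exp (- z\<^sup>2 / 2)"] by simp
  then have "z\<^sup>2 \<le> 2 * ln (1 / b)" using assms by (simp add: ln_div)
  then show ?thesis by (rule real_le_rsqrt)
next
  case False
  moreover have "0 \<le> sqrt (2 * ln (1 / b))" using assms by (simp add: ln_div)
  ultimately show ?thesis by linarith
qed

lemma Phi_le_linear:
  assumes "0 \<le> t"
  shows "Phi t \<le> 1/2 + 2/5 * t"
proof -
  have "((\<lambda>t. Phi t - 2/5 * t) has_real_derivative std_normal_density x - 2/5) (at x)" for x
    by (auto intro!: derivative_eq_intros Phi_has_real_derivative)
  then have "Phi t - 2/5 * t \<le> Phi 0 - 2/5 * 0"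
    using std_normal_density_le
    by (intro DERIV_nonpos_imp_nonincreasing[OF assms, of "\<lambda>t. Phi t - 2/5 * t"])
      (metis diff_le_0_iff_le)
  then show ?thesis by simp
qed

lemma std_normal_density_ge: "398/1000 * exp (- x\<^sup>2 / 2) \<le> std_normal_density x"
proof -
  have "2 * pi \<le> (1000/398)\<^sup>2"
    using pi_approx by (simp add: power2_eq_square)
  then have "sqrt (2 * pi) \<le> 1000/398"
    by (intro real_le_lsqrt) auto
  then have "398/1000 \<le> 1 / sqrt (2 * pi)"
    by (simp add: field_simps)
  then show ?thesis unfolding std_normal_density_def by (intro mult_right_mono) auto
qed

text \<open>Reduces a tail bound to an elementary inequality, via the hazard bound at
  \<open>x + d\<close> and 1592/1000 = 4 * 398/1000. The shift \<open>d\<close> is the slack between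
  \<open>x\<close> and the quantile of level \<open>exp (- x\<^sup>2) / 4\<close>.\<close>

lemma gauss_tail_ge:
  assumes "0 \<le> x" "0 \<le> d" "1 + x + d \<le> 1592/1000 * exp (x\<^sup>2 / 2 - x * d - d\<^sup>2 / 2)"
  shows "exp (- x\<^sup>2) / 4 \<le> gauss_tail (x + d)"
proof -
  have "exp (- x\<^sup>2) * (1 + x + d) \<le> exp (- x\<^sup>2) * (1592/1000 * exp (x\<^sup>2 / 2 - x * d - d\<^sup>2 / 2))"
    using assms by (intro mult_left_mono) auto
  also have "\<dots> = 4 * (398/1000 * exp (- (x + d)\<^sup>2 / 2))"
    by (simp flip: exp_add) (simp add: power2_eq_square field_simps)
  also have "\<dots> \<le> 4 * std_normal_density (x + d)"
    using std_normal_density_ge[of "x + d"] by simp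
  also have "\<dots> \<le> 4 * ((1 + (x + d)) * gauss_tail (x + d))"
    using mills_ratio_lower[of "x + d"] assms by simp
  finally have "(1 + x + d) * exp (- x\<^sup>2) \<le> (1 + x + d) * (4 * gauss_tail (x + d))"
    by (simp add: algebra_simps)
  then have "exp (- x\<^sup>2) \<le> 4 * gauss_tail (x + d)"
    using assms by (subst (asm) mult_le_cancel_left_pos) auto
  then show ?thesis by simp
qed

section \<open>Numerical estimates of exponentials and bounds on the significance levels\<close>

text \<open>Raising to the power \<open>n\<close> turns a bound on \<open>exp (m / n)\<close> into a
  comparison of rational numerals, using e < 2.72.\<close>

lemma exp_le_if_power_le:
  fixes c :: real
  assumes "real n * x = real m" "n > 0" "0 \<le> c" "(272/100) ^ m \<le> c ^ n"
  shows "exp x \<le> c"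
proof -
  have "exp x ^ n = exp 1 ^ m"
    using assms(1) by (simp flip: exp_of_nat_mult)
  also have "\<dots> \<le> (272/100) ^ m"
    using e_less_272 by (intro power_mono) auto
  finally have "exp x ^ n \<le> c ^ n" using assms(4) by linarith
  then show ?thesis using assms(2,3) by (simp add: power_mono_iff)
qed

lemma le_div_of_nonincreasing_sums:
  fixes a :: "nat \<Rightarrow> real"
  assumes nonneg: "\<And>k. k \<ge> 1 \<Longrightarrow> a k \<ge> 0"
    and sums: "(\<lambda>k. a (Suc k)) sums \<alpha>"
    and mono: "\<And>i j. 1 \<le> i \<Longrightarrow> i \<le> j \<Longrightarrow> a j \<le> a i"
    and k: "k \<ge> 1"
  shows "a k \<le> \<alpha> / real k"
proof -
  have "real k * a k = (\<Sum>i<k. a k)" by simp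
  also have "\<dots> \<le> (\<Sum>i<k. a (Suc i))"
    by (intro sum_mono mono) auto
  also have "\<dots> \<le> \<alpha>"
    using sum_le_suminf[OF sums_summable[OF sums], of "{..<k}"] nonneg sums_unique[OF sums] by auto
  finally show ?thesis using k by (simp add: field_simps)
qed

lemma le_of_sums:
  fixes a :: "nat \<Rightarrow> real"
  assumes nonneg: "\<And>k. k \<ge> 1 \<Longrightarrow> a k \<ge> 0"
    and sums: "(\<lambda>k. a (Suc k)) sums \<alpha>"
    and k: "k \<ge> 1"
  shows "a k \<le> \<alpha>"
  using sum_le_suminf[OF sums_summable[OF sums], of "{k - 1}"] nonneg sums_unique[OF sums] k by auto

lemma borel_measurable_Phi [measurable]: "Phi \<in> borel_measurable borel"
  by (intro borel_measurable_continuous_onI continuous_on_Phi)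

section \<open>Rejection probability of a single hypothesis\<close>

context prob_space
begin

lemma prob_normal_ge:
  assumes X: "distributed M lborel X (normal_density m s)" and s: "0 < s"
  shows "prob {\<omega> \<in> space M. c \<le> X \<omega>} = gauss_tail ((c - m) / s)"
proof -
  \<comment> \<open>Standardised with reversed sign, so that the upper tail of \<open>X\<close>
    becomes a lower tail of \<open>Y\<close>, which is what \<open>Phi\<close> measures.\<close>
  define Y where "Y = (\<lambda>\<omega>. m / s + (- 1 / s) * X \<omega>)"
  have "distributed M lborel Y (normal_density (m / s + (- 1 / s) * m) (\<bar>- 1 / s\<bar> * s))"
    unfolding Y_def using s by (intro normal_density_affine[OF X]) auto
  then have Y: "distributed M lborel Y std_normal_density"
    using s by simp
  then have distr: "distr M lborel Y = std_normal_distribution"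
    by (rule distributed_distr_eq_density)
  have meas: "Y \<in> measurable M lborel"
    using Y by (rule distributed_measurable)
  have "{\<omega> \<in> space M. c \<le> X \<omega>} = Y -` {.. - ((c - m) / s)} \<inter> space M"
    using s by (auto simp: Y_def field_simps)
  then have "prob {\<omega> \<in> space M. c \<le> X \<omega>} = measure (distr M lborel Y) {.. - ((c - m) / s)}"
    using meas by (subst measure_distr) auto
  also have "\<dots> = Phi (- ((c - m) / s))"
    by (simp only: distr Phi_def)
  finally show ?thesis by (simp only: Phi_minus)
qed

lemma prob_pval_le:
  assumes Z: "distributed M lborel (Z k) (normal_density m 1)" and b: "b \<le> gauss_tail x"
  shows "prob {\<omega> \<in> space M. pval Z k \<omega> \<le> b} \<le> gauss_tail (x - m)"
proof -
  have [measurable]: "Z k \<in> borel_measurable M"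
    using distributed_measurable[OF Z] by simp
  have "prob {\<omega> \<in> space M. pval Z k \<omega> \<le> b} \<le> prob {\<omega> \<in> space M. x \<le> Z k \<omega>}"
  proof (rule finite_measure_mono)
    show "{\<omega> \<in> space M. pval Z k \<omega> \<le> b} \<subseteq> {\<omega> \<in> space M. x \<le> Z k \<omega>}"
    proof safe
      fix \<omega> assume "pval Z k \<omega> \<le> b"
      then have "Phi x \<le> Phi (Z k \<omega>)" using b by (simp add: pval_def del: Phi_le_iff)
      then show "x \<le> Z k \<omega>" by simp
    qed
  qed measurable
  then show ?thesis by (simp add: prob_normal_ge[OF Z])
qed

text \<open>The level \<open>b\<close> may be 0 or very small, with no or a very large quantile;
  enlarging it to \<open>c\<close> keeps the quantile under control.\<close>

lemma prob_pval_le_exp: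
  assumes Z: "distributed M lborel (Z k) (normal_density m 1)" and "0 \<le> m"
    and "b \<le> c" "0 < c" "c < 1"
  shows "prob {\<omega> \<in> space M. pval Z k \<omega> \<le> b} \<le> exp (m * (1 + sqrt (2 * ln (1 / c)))) * c"
proof -
  obtain z where "Phi z = 1 - c"
    using Phi_surj[of "1 - c"] assms by auto
  then have z: "gauss_tail z = c" by simp
  have "prob {\<omega> \<in> space M. pval Z k \<omega> \<le> b} \<le> gauss_tail (z - m)"
    using assms z by (intro prob_pval_le[where Z = Z and k = k, OF Z]) auto
  also have "\<dots> \<le> exp (m * (1 + sqrt (2 * ln (1 / c)))) * gauss_tail z"
    using assms by (intro gauss_tail_shift_le gauss_tail_quantile_le[OF z]) (auto simp: ln_div)
  finally show ?thesis by (simp only: z)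
qed

text \<open>The quantile bound \<open>sqrt (2 * ln (1 / b))\<close> grows more slowly than
  \<open>1 / sqrt b\<close>, so a mean of order \<open>sqrt b\<close> costs only a constant
  factor.\<close>

lemma prob_pval_le_small_mean:
  assumes Z: "distributed M lborel (Z k) (normal_density m 1)" and m: "0 \<le> m" "m \<le> 2/5 * sqrt b"
    and b: "0 \<le> b" "b \<le> 1/4"
  shows "prob {\<omega> \<in> space M. pval Z k \<omega> \<le> b} \<le> 19/10 * b"
proof (cases "b = 0")
  case True
  \<comment> \<open>A p-value is never 0, so level 0 never rejects.\<close>
  have "pval Z k \<omega> > 0" for \<omega> using Phi_less_1 by (simp add: pval_def)
  then have "{\<omega> \<in> space M. pval Z k \<omega> \<le> b} = {}"
    using True by (auto simp: not_le)
  then show ?thesis using True by (simp only:) simp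
next
  case False
  define r where "r = sqrt b"
  have b_eq: "b = r\<^sup>2" using b by (simp add: r_def)
  have r: "0 < r" using b False by (simp add: r_def)
  have "r\<^sup>2 \<le> (1/2)\<^sup>2" using b b_eq by (simp add: power2_eq_square)
  then have r2: "r \<le> 1/2" by (rule power2_le_imp_le) simp
  define s where "s = sqrt (2 * ln (1 / b))"
  have ln: "ln (1 / b) = 2 * ln (1 / r)"
    using r by (simp add: b_eq ln_div ln_realpow)
  \<comment> \<open>Aim: \<open>r * s \<le> 1\<close>. The logarithm bound reduces this to 4r(1 - r)
    \<le> 1, which holds by completing the square.\<close>
  have "ln (1 / r) \<le> 1 / r - 1" using r by (intro ln_le_minus_one) simp
  then have "4 * r\<^sup>2 * ln (1 / r) \<le> 4 * r\<^sup>2 * (1 / r - 1)"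
    by (intro mult_left_mono) auto
  also have "\<dots> = 1 - (2 * r - 1)\<^sup>2" using r by (simp add: power2_eq_square field_simps)
  also have "\<dots> \<le> 1" by simp
  finally have "r\<^sup>2 * (2 * ln (1 / b)) \<le> 1" by (simp add: ln)
  then have "sqrt (r\<^sup>2 * (2 * ln (1 / b))) \<le> sqrt 1" by (rule real_sqrt_le_mono)
  then have rs: "r * s \<le> 1" using r by (simp add: real_sqrt_mult s_def)
  have s0: "0 \<le> s" using r r2 by (simp add: s_def ln)
  have "m * (1 + s) \<le> 2/5 * r * (1 + s)" using m s0 by (intro mult_right_mono) (auto simp: r_def)
  also have "\<dots> = 2/5 * (r + r * s)" by (simp add: algebra_simps)
  also have "\<dots> \<le> 3/5" using r2 rs by simp
  finally have "exp (m * (1 + s)) \<le> exp (3/5)" by simp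
  also have "\<dots> \<le> 19/10"
    by (rule exp_le_if_power_le[of 5 _ 3]) (simp_all add: power_divide)
  finally have "exp (m * (1 + s)) * b \<le> 19/10 * b" using b by (intro mult_right_mono) auto
  moreover have "prob {\<omega> \<in> space M. pval Z k \<omega> \<le> b} \<le> exp (m * (1 + s)) * b"
    unfolding s_def using m b False by (intro prob_pval_le_exp[where Z = Z and k = k, OF Z]) auto
  ultimately show ?thesis by linarith
qed

section \<open>Power bounds for the Bonferroni test with arbitrarily many signals and for the
  Stouffer test\<close>

lemma power_bonferroni_le:
  assumes Z: "\<And>k. k \<ge> 1 \<Longrightarrow> Z k \<in> borel_measurable M"
    and bound: "\<And>k. k \<ge> 1 \<Longrightarrow> prob {\<omega> \<in> space M. pval Z k \<omega> \<le> a k} \<le> f k"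
    and sums: "(\<lambda>k. f (Suc k)) sums s"
  shows "power M (bonferroni_rejects a Z) \<le> s"
proof -
  \<comment> \<open>Shifted by one: \<open>A k\<close> is the rejection event of hypothesis
    \<open>Suc k\<close>.\<close>
  define A where "A k = {\<omega> \<in> space M. pval Z (Suc k) \<omega> \<le> a (Suc k)}" for k
  have A: "range A \<subseteq> sets M"
  proof safe
    fix k
    have [measurable]: "Z (Suc k) \<in> borel_measurable M" by (rule Z) simp
    show "A k \<in> sets M" unfolding A_def pval_def by measurable
  qed
  have le: "prob (A k) \<le> f (Suc k)" for k
    unfolding A_def by (rule bound) simp
  have summable: "summable (\<lambda>k. prob (A k))"
    using le by (intro summable_comparison_test[OF _ sums_summable[OF sums]]) auto
  have "power M (bonferroni_rejects a Z) = prob (\<Union>k. A k)"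
    unfolding power_def bonferroni_rejects_def A_def
    by (rule arg_cong[where f = prob]) (auto, metis Suc_le_D One_nat_def)
  also have "\<dots> \<le> (\<Sum>k. prob (A k))"
    using A summable by (rule finite_measure_subadditive_countably)
  also have "\<dots> \<le> (\<Sum>k. f (Suc k))"
    by (intro suminf_le le summable sums_summable[OF sums])
  finally show ?thesis using sums_unique[OF sums] by simp
qed

lemma power_bonferroni_less:
  assumes Z: "\<And>k. k \<ge> 1 \<Longrightarrow> distributed M lborel (Z k) (normal_density (\<mu> k) 1)"
    and \<mu>: "\<And>k. k \<ge> 1 \<Longrightarrow> \<mu> k \<ge> 0"
    and \<alpha>: "0 < \<alpha>" "\<alpha> \<le> 1 / 4"
    and a: "\<And>k. k \<ge> 1 \<Longrightarrow> a k \<ge> 0"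
    and sums: "(\<lambda>k. a (Suc k)) sums \<alpha>"
    and small: "\<And>k. k \<ge> 1 \<Longrightarrow> \<mu> k < 0.25 / sqrt (2 * ln (real k ^ 2 / \<alpha>))"
  shows "power M (bonferroni_rejects a Z) < 4 * \<alpha>"
proof -
  \<comment> \<open>7/17 is a rational upper bound for (1 + 1/R)/4 when R is at least 1.63.\<close>
  define E :: real where "E = exp (7/17)"
  define f where "f k = E * (a k + \<alpha> / real k ^ 2)" for k
  have "(\<lambda>k. \<alpha> * (1 / (real k + 1)\<^sup>2)) sums (\<alpha> * (pi\<^sup>2 / 6))"
    using sums_mult[OF inverse_squares_sums, of \<alpha>] by (simp add: add.commute)
  then have fsums: "(\<lambda>k. f (Suc k)) sums (E * (\<alpha> + \<alpha> * (pi\<^sup>2 / 6)))"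
    unfolding f_def by (intro sums_mult sums_add sums) (simp add: add.commute)
  have "power M (bonferroni_rejects a Z) \<le> E * (\<alpha> + \<alpha> * (pi\<^sup>2 / 6))"
  proof (rule power_bonferroni_le[OF _ _ fsums])
    fix k :: nat assume k: "1 \<le> k"
    show "Z k \<in> borel_measurable M"
      using distributed_measurable[OF Z[OF k]] by simp
    \<comment> \<open>The floor \<open>\<alpha> / real k ^ 2\<close> keeps the quantile of level
      \<open>c\<close> below \<open>R\<close>, which the mean bound cancels, and adds only
      \<open>\<alpha> * pi\<^sup>2 / 6\<close> to the sum of the levels.\<close>
    define c where "c = max (a k) (\<alpha> / real k ^ 2)"
    define R where "R = sqrt (2 * ln (real k ^ 2 / \<alpha>))"
    have k1: "1 \<le> real k ^ 2" using k by simp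
    have "a k \<le> \<alpha>" using a sums k by (rule le_of_sums)
    moreover have "\<alpha> / real k ^ 2 \<le> \<alpha> / 1"
      using k k1 \<alpha> by (intro divide_left_mono) auto
    ultimately have c1: "c \<le> 1/4" using \<alpha> unfolding c_def by linarith
    have ck: "\<alpha> / real k ^ 2 \<le> c" by (simp add: c_def)
    moreover have pos: "0 < \<alpha> / real k ^ 2" using \<alpha> k by simp
    ultimately have c0: "0 < c" by linarith
    have "4 * \<alpha> \<le> 1 * real k ^ 2" using \<alpha> k1 by simp
    then have "4 \<le> real k ^ 2 / \<alpha>" using \<alpha> by (simp add: le_divide_eq)
    then have "ln 4 \<le> ln (real k ^ 2 / \<alpha>)" by simp
    moreover have "ln 4 = 2 * ln (2::real)" using ln_realpow[of "2::real" 2] by simp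
    ultimately have "(163/100)\<^sup>2 \<le> 2 * ln (real k ^ 2 / \<alpha>)"
      using ln2_ge_two_thirds by (simp add: power2_eq_square)
    then have R: "163/100 \<le> R" unfolding R_def by (rule real_le_rsqrt)
    have "1 / c \<le> real k ^ 2 / \<alpha>"
      using le_imp_inverse_le[OF ck pos] by (simp add: inverse_eq_divide)
    then have s: "sqrt (2 * ln (1 / c)) \<le> R"
      using c0 unfolding R_def by (intro real_sqrt_le_mono) (simp add: ln_mono)
    have "\<mu> k * (1 + sqrt (2 * ln (1 / c))) \<le> \<mu> k * (1 + R)"
      using s \<mu>[OF k] by (intro mult_left_mono) auto
    also have "\<dots> \<le> 1/4 / R * (1 + R)"
      using small[OF k] R by (intro mult_right_mono) (auto simp: R_def)
    also have "\<dots> \<le> 7/17" using R by (simp add: field_simps)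
    finally have "exp (\<mu> k * (1 + sqrt (2 * ln (1 / c)))) \<le> E" by (simp add: E_def)
    moreover have "c \<le> a k + \<alpha> / real k ^ 2"
      using a[OF k] pos by (simp add: c_def)
    ultimately have "exp (\<mu> k * (1 + sqrt (2 * ln (1 / c)))) * c \<le> f k"
      unfolding f_def using c0 by (intro mult_mono) (auto simp: E_def)
    moreover have "prob {\<omega> \<in> space M. pval Z k \<omega> \<le> a k} \<le>
        exp (\<mu> k * (1 + sqrt (2 * ln (1 / c)))) * c"
      using c0 c1
      by (intro prob_pval_le_exp[where Z = Z and k = k, OF Z[OF k] \<mu>[OF k]]) (simp add: c_def, auto)
    ultimately show "prob {\<omega> \<in> space M. pval Z k \<omega> \<le> a k} \<le> f k" by linarith
  qed
  also have "E \<le> 1512/1000"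
    unfolding E_def by (rule exp_le_if_power_le[of 17 _ 7]) (simp_all add: power_divide)
  then have "E * (\<alpha> + \<alpha> * (pi\<^sup>2 / 6)) \<le> 1512/1000 * (\<alpha> + \<alpha> * (pi\<^sup>2 / 6))"
    using \<alpha> by (intro mult_right_mono) auto
  \<comment> \<open>The constants are nearly exhausted: 1.512 * (1 + \<open>pi\<^sup>2 / 6\<close>)
    is about 3.9992.\<close>
  also have "\<dots> < 4 * \<alpha>"
  proof -
    have "pi\<^sup>2 \<le> (31416/10000)\<^sup>2"
      using pi_approx by (intro power_mono) auto
    then have "1512/1000 * (1 + pi\<^sup>2 / 6) < 4" by (simp add: power2_eq_square)
    then have "\<alpha> * (1512/1000 * (1 + pi\<^sup>2 / 6)) < \<alpha> * 4"
      using \<alpha> by (intro mult_strict_left_mono) auto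
    then show ?thesis by (simp add: algebra_simps)
  qed
  finally show ?thesis .
qed

text \<open>Only the crossing at the given \<open>k\<close> is used: there the mean of the sum
  exceeds the threshold by at least \<open>Ck k \<beta>\<close> standard deviations, and the tail
  beyond that is at most \<open>\<beta>\<close>.\<close>

lemma power_stouffer_ge:
  assumes indep: "indep_vars (\<lambda>_. borel) Z {1..}"
    and Z: "\<And>k. k \<ge> 1 \<Longrightarrow> distributed M lborel (Z k) (normal_density (\<mu> k) 1)"
    and \<beta>: "0 < \<beta>" "\<beta> < 1"
    and k: "k \<ge> 1" and large: "(Ck k \<alpha> + Ck k \<beta>) * sqrt (real k) \<le> (\<Sum>i=1..k. \<mu> i)"
  shows "1 - \<beta> \<le> power M (stouffer_rejects \<alpha> Z)"
proof -
  define C where "C = Ck k \<beta>"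
  define S where "S = (\<lambda>\<omega>. \<Sum>i=1..k. Z i \<omega>)"
  have rejects: "stouffer_rejects \<alpha> Z \<omega> \<longleftrightarrow> (\<exists>k\<ge>1. (\<Sum>i=1..k. Z i \<omega>) \<ge> Ck k \<alpha> * sqrt (real k))" for \<omega>
    by (simp add: stouffer_rejects_def pval_def)
  have [measurable]: "Z i \<in> borel_measurable M" if "i \<in> {1..n}" for i n
    using distributed_measurable[OF Z[of i]] that by simp
  have "distributed M lborel S (normal_density (\<Sum>i=1..k. \<mu> i) (sqrt (\<Sum>i=1..k. 1\<^sup>2)))"
    unfolding S_def using k indep
    by (intro sum_indep_normal Z) (auto intro: indep_vars_subset)
  then have S: "distributed M lborel S (normal_density (\<Sum>i=1..k. \<mu> i) (sqrt (real k)))"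
    by simp
  \<comment> \<open>The iterated logarithm is negative at \<open>k = 1\<close>; this bound covers
    all \<open>k\<close>, since \<open>exp (- 1/2) \<le> 2/3 \<le> ln 2\<close>.\<close>
  have ln: "ln (ln (2 * real k)) \<ge> - 1/2"
  proof -
    have "exp (- 1/2) \<le> (2/3::real)"
      using exp_lower_Taylor_quadratic[of "1/2::real"]
      by (simp add: exp_minus power2_eq_square inverse_eq_divide divide_le_eq)
    also note ln2_ge_two_thirds
    also have "ln 2 \<le> ln (2 * real k)"
      using k by simp
    finally have le: "exp (- 1/2) \<le> ln (2 * real k)" .
    show ?thesis using ln_mono[OF le] by simp
  qed
  have "ln 4 \<le> ln (52/10::real)" by simp
  moreover have "ln 4 = 2 * ln (2::real)" using ln_realpow[of "2::real" 2] by simp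
  ultimately have "ln (52/10) \<ge> (4/3::real)" using ln2_ge_two_thirds by linarith
  then have ln\<beta>: "ln (52/10 / \<beta>) \<ge> 4/3 - ln \<beta>"
    using ln_divide_pos[of "52/10" \<beta>] \<beta> by linarith
  have "ln \<beta> \<le> 0" using \<beta> by simp
  then have "0 \<le> ln (ln (2 * real k)) + 72/100 * ln (52/10 / \<beta>)"
    using ln ln\<beta> by linarith
  then have C2: "C\<^sup>2 = (17/10)\<^sup>2 * (ln (ln (2 * real k)) + 72/100 * ln (52/10 / \<beta>))" and C0: "0 \<le> C"
    unfolding C_def Ck_def by (simp_all add: power_mult_distrib power_divide)
  \<comment> \<open>Half of 1.7 squared times 0.72 is 1.0404, so the coefficient of
    \<open>- ln \<beta>\<close> is at least 1; the constant 0.72 * 4/3 = 0.96 outweighs the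
    -1/2.\<close>
  have "- C\<^sup>2 / 2 \<le> ln \<beta>"
    using ln ln\<beta> \<open>ln \<beta> \<le> 0\<close> unfolding C2 power_divide by simp argo
  then have "exp (- C\<^sup>2 / 2) \<le> \<beta>" using \<beta> by (simp add: ln_ge_iff)
  then have tail: "gauss_tail C \<le> \<beta>"
    using gauss_tail_le_exp[OF C0] \<beta> by simp
  have "(Ck k \<alpha> * sqrt (real k) - (\<Sum>i=1..k. \<mu> i)) / sqrt (real k) \<le> - C"
    using large k by (simp add: C_def field_simps)
  then have "Phi ((Ck k \<alpha> * sqrt (real k) - (\<Sum>i=1..k. \<mu> i)) / sqrt (real k)) \<le> Phi (- C)"
    by simp
  then have "1 - \<beta> \<le> prob {\<omega> \<in> space M. Ck k \<alpha> * sqrt (real k) \<le> S \<omega>}"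
    using tail k by (simp add: prob_normal_ge[OF S] Phi_minus)
  also have "\<dots> \<le> power M (stouffer_rejects \<alpha> Z)"
    unfolding power_def rejects
  proof (rule finite_measure_mono)
    show "{\<omega> \<in> space M. \<exists>k\<ge>1. Ck k \<alpha> * sqrt (real k) \<le> (\<Sum>i = 1..k. Z i \<omega>)} \<in> events"
      by measurable
  qed (use k in \<open>auto simp: S_def\<close>)
  finally show ?thesis .
qed

end

section \<open>Lower tail bounds for the quantiles of late hypotheses\<close>

lemma gauss_tail_ge_exp_square:
  assumes "0 \<le> x"
  shows "exp (- x\<^sup>2) / 4 \<le> gauss_tail x"
proof -
  have "1 + x \<le> 1592/1000 * (1 + x\<^sup>2 / 2)"
    \<comment> \<open>125/199 minimises the quadratic difference of the two sides.\<close>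
    using zero_le_power2[of "x - 125/199"] by (simp add: power2_eq_square algebra_simps)
  also have "\<dots> \<le> 1592/1000 * exp (x\<^sup>2 / 2)"
    by (intro mult_left_mono exp_ge_add_one_self) simp
  finally show ?thesis using gauss_tail_ge[OF assms, of 0] by simp
qed

text \<open>The tangent of \<open>exp\<close> at 1/2, with its slope rounded down to 16/10.\<close>

lemma exp_ge_tangent_half: "16/10 * (1/2 + x) \<le> exp (x::real)"
proof (cases "0 \<le> 1/2 + x")
  case True
  have "16/10 \<le> exp (1/2 :: real)"
    using exp_lower_Taylor_quadratic[of "1/2::real"] by (simp add: power2_eq_square)
  moreover have "1/2 + x \<le> exp (x - 1/2)"
    using exp_ge_add_one_self[of "x - 1/2"] by simp
  ultimately have "16/10 * (1/2 + x) \<le> exp (1/2) * exp (x - 1/2)"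
    using True by (intro mult_mono) auto
  then show ?thesis by (simp flip: exp_add)
next
  case False
  then have "16/10 * (1/2 + x) \<le> 0" by simp
  also have "0 \<le> exp x" by simp
  finally show ?thesis .
qed

lemma gauss_tail_shift_quarter_ge:
  assumes "14/10 \<le> x"
  shows "exp (- x\<^sup>2) / 4 \<le> gauss_tail (x + 1/4)"
proof (rule gauss_tail_ge)
  have "14/10 * x \<le> x\<^sup>2" using assms by (simp add: power2_eq_square)
  then have "1 + x + 1/4 \<le> 1592/1000 * (16/10 * (1/2 + (x\<^sup>2 / 2 - x * (1/4) - (1/4)\<^sup>2 / 2)))"
    using assms by (simp add: power_divide)
  then show "1 + x + 1/4 \<le> 1592/1000 * exp (x\<^sup>2 / 2 - x * (1/4) - (1/4)\<^sup>2 / 2)"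
    using exp_ge_tangent_half[of "x\<^sup>2 / 2 - x * (1/4) - (1/4)\<^sup>2 / 2"] by linarith
qed (use assms in auto)

lemma gauss_tail_shift_two_fifths_ge:
  assumes "2 \<le> x"
  shows "exp (- x\<^sup>2) / 4 \<le> gauss_tail (x + 2/5)"
proof (rule gauss_tail_ge)
  have "2 * x \<le> x\<^sup>2" using assms by (simp add: power2_eq_square)
  then have "1 + x + 2/5 \<le> 1592/1000 * (16/10 * (1/2 + (x\<^sup>2 / 2 - x * (2/5) - (2/5)\<^sup>2 / 2)))"
    using assms by (simp add: power_divide)
  then show "1 + x + 2/5 \<le> 1592/1000 * exp (x\<^sup>2 / 2 - x * (2/5) - (2/5)\<^sup>2 / 2)"
    using exp_ge_tangent_half[of "x\<^sup>2 / 2 - x * (2/5) - (2/5)\<^sup>2 / 2"] by linarith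
qed (use assms in auto)

text \<open>Linearising \<open>Phi\<close> at 0 leaves 2y/5 - 2d/5 against
  \<open>y\<^sup>2 / 4\<close>, whose difference is a square once 2d/5 = 4/25, that is
  \<open>d = 2/5\<close>. For \<open>d = 1/4\<close> the deficit is 0.06, which
  \<open>\<alpha> \<ge> 1/16\<close> pays for.\<close>

lemma Phi_diff_le:
  assumes d: "(d = 2/5 \<and> 0 \<le> \<alpha>) \<or> (d = 1/4 \<and> 1/16 \<le> (\<alpha>::real))"
    and y: "1/2 + y\<^sup>2 / 4 \<le> \<delta>"
  shows "Phi (y - d) \<le> \<delta> + \<alpha>"
proof (cases "d \<le> y")
  case True
  have "Phi (y - d) \<le> 1/2 + 2/5 * (y - d)" using True by (intro Phi_le_linear) simp
  moreover have "0 \<le> (y / 2 - 2/5)\<^sup>2" by simp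
  then have "2/5 * y - 4/25 \<le> y\<^sup>2 / 4" by (simp add: power2_eq_square algebra_simps)
  ultimately show ?thesis using d y by argo
next
  case False
  then have "Phi (y - d) \<le> Phi 0" by (simp del: Phi_0)
  moreover have "0 \<le> y\<^sup>2" by simp
  ultimately show ?thesis using d y Phi_0 by argo
qed

section \<open>Power bound for finitely many signals\<close>

context prob_space
begin

text \<open>The threshold below is meant for \<open>2 * \<delta> \<le> N\<close>. Otherwise the square root is taken of a
  negative number, where \<open>sqrt (- x) = - sqrt x\<close>, so the threshold exceeds
  \<open>sqrt (ln (k / (4 * \<alpha>)))\<close>; then the gap between the latter and the true quantile of
  level \<open>\<alpha> / k\<close> is needed as well.\<close>

lemma prob_pval_le_late:
  assumes Z: "distributed M lborel (Z k) (normal_density m 1)"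
    and \<alpha>: "0 < \<alpha>" and \<delta>: "\<alpha> \<le> \<delta>" "\<delta> + 3 * \<alpha> < 1"
    and N: "1 \<le> N" and k: "N\<^sup>2 / \<alpha> < real k" and b: "b \<le> \<alpha> / real k"
    and m: "m < sqrt (ln (real k / (4 * \<alpha>))) - sqrt (2 * ln (N / (2 * \<delta>)))"
  shows "prob {\<omega> \<in> space M. pval Z k \<omega> \<le> b} \<le> (if 2 * \<delta> \<le> N then \<delta> / N else \<delta> + \<alpha>)"
proof -
  define x where "x = sqrt (ln (real k / (4 * \<alpha>)))"
  have "1 / \<alpha> \<le> N\<^sup>2 / \<alpha>" using N \<alpha> by (intro divide_right_mono) auto
  then have "1 / \<alpha> < real k" using k by linarith
  then have k\<alpha>: "1 / (4 * \<alpha>\<^sup>2) < real k / (4 * \<alpha>)"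
    using \<alpha> by (simp add: field_simps power2_eq_square)
  \<comment> \<open>Turns upper bounds on \<open>\<alpha>\<close> into lower bounds on
    \<open>real k / (4 * \<alpha>)\<close>, hence on \<open>x\<close>.\<close>
  have ratio: "r < real k / (4 * \<alpha>)" if "4 * r * \<alpha>\<^sup>2 \<le> 1" for r
  proof -
    have "r \<le> 1 / (4 * \<alpha>\<^sup>2)" using that \<alpha> by (simp add: field_simps)
    then show ?thesis using k\<alpha> by linarith
  qed
  have "\<alpha> * \<alpha> \<le> 1/4 * (1/4)" using \<alpha> \<delta> by (intro mult_mono) auto
  then have one: "1 < real k / (4 * \<alpha>)" by (intro ratio) (simp add: power2_eq_square)
  then have x2: "x\<^sup>2 = ln (real k / (4 * \<alpha>))" and x0: "0 \<le> x" by (simp_all add: x_def)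
  have kpos: "0 < real k" using one \<alpha> by (auto intro: gr0I)
  have exp_x: "exp (- x\<^sup>2) / 4 = \<alpha> / real k"
    using one kpos \<alpha> by (simp add: x2 exp_minus inverse_eq_divide)
  show ?thesis
  proof (cases "2 * \<delta> \<le> N")
    case True
    define u where "u = sqrt (2 * ln (N / (2 * \<delta>)))"
    have ln0: "0 \<le> ln (N / (2 * \<delta>))" using True \<alpha> \<delta> by simp
    then have u: "0 \<le> u" "u\<^sup>2 = 2 * ln (N / (2 * \<delta>))" by (simp_all add: u_def)
    have "prob {\<omega> \<in> space M. pval Z k \<omega> \<le> b} \<le> gauss_tail (x - m)"
      using b gauss_tail_ge_exp_square[OF x0] exp_x
      by (intro prob_pval_le[where Z = Z and k = k, OF Z]) linarith
    also have "\<dots> \<le> gauss_tail u" using m by (simp add: x_def u_def)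
    also have "\<dots> \<le> exp (- u\<^sup>2 / 2) / 2" by (rule gauss_tail_le_exp[OF u(1)])
    \<comment> \<open>The factor 1/2 of the tail bound matches the 2 in
      \<open>N / (2 * \<delta>)\<close>, so the value is exact.\<close>
    also have "\<dots> = \<delta> / N" using N \<alpha> \<delta> by (simp add: u(2) exp_minus inverse_eq_divide)
    finally show ?thesis using True by simp
  next
    case False
    define y where "y = sqrt (2 * ln (2 * \<delta> / N))"
    have "ln (N / (2 * \<delta>)) = - ln (2 * \<delta> / N)"
      using N \<alpha> \<delta> by (simp add: ln_div)
    then have y_eq: "sqrt (2 * ln (N / (2 * \<delta>))) = - y"
      by (simp add: y_def flip: real_sqrt_minus)
    have "0 \<le> ln (2 * \<delta> / N)" using False N by simp
    then have y2: "y\<^sup>2 = 2 * ln (2 * \<delta> / N)" by (simp add: y_def)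
    have "1 + y\<^sup>2 / 2 \<le> exp (y\<^sup>2 / 2)" by (rule exp_ge_add_one_self)
    also have "\<dots> = 2 * \<delta> / N" using False N \<alpha> \<delta> by (simp add: y2)
    also have "\<dots> \<le> 2 * \<delta> / 1" using N \<alpha> \<delta> by (intro divide_left_mono) auto
    finally have \<delta>y: "1/2 + y\<^sup>2 / 4 \<le> \<delta>" by simp
    have "1/2 < \<delta>" using False N by simp
    then have \<alpha>6: "\<alpha> \<le> 1/6" using \<delta> by simp
    \<comment> \<open>A smaller \<open>\<alpha>\<close> makes \<open>x\<close> larger and allows a
      larger \<open>d\<close>: \<open>x\<close> is at least 1.4 when \<open>\<alpha>\<close> lies
      between 1/16 and 1/6, since \<open>exp (196/100) \<le> 9\<close>, and at least 2 below 1/16,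
      since \<open>exp 4 \<le> 64\<close>.\<close>
    obtain d where d: "(d = 2/5 \<and> 0 \<le> \<alpha>) \<or> (d = 1/4 \<and> 1/16 \<le> \<alpha>)"
      and tail: "exp (- x\<^sup>2) / 4 \<le> gauss_tail (x + d)"
    proof (cases "1/16 \<le> \<alpha>")
      case True
      have "\<alpha> * \<alpha> \<le> 1/6 * (1/6)" using \<alpha> \<alpha>6 by (intro mult_mono) auto
      then have "9 < real k / (4 * \<alpha>)" by (intro ratio) (simp add: power2_eq_square)
      moreover have "exp (196/100) \<le> (9::real)"
        by (rule exp_le_if_power_le[of 25 _ 49]) (simp_all add: power_divide)
      ultimately have "exp (196/100) \<le> real k / (4 * \<alpha>)" by linarith
      then have "196/100 \<le> x\<^sup>2" using one by (subst x2, subst ln_ge_iff) auto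
      then have "14/10 \<le> x" by (intro power2_le_imp_le[OF _ x0]) (simp add: power_divide)
      then show ?thesis using True gauss_tail_shift_quarter_ge that by blast
    next
      case False
      have "\<alpha> * \<alpha> \<le> 1/16 * (1/16)" using \<alpha> False by (intro mult_mono) auto
      then have "64 < real k / (4 * \<alpha>)" by (intro ratio) (simp add: power2_eq_square)
      moreover have "exp 4 \<le> (64::real)"
        by (rule exp_le_if_power_le[of 1 _ 4]) (simp_all add: power_divide)
      ultimately have "exp 4 \<le> real k / (4 * \<alpha>)" by linarith
      then have "4 \<le> x\<^sup>2" using one by (subst x2, subst ln_ge_iff) auto
      then have "2 \<le> x" by (intro power2_le_imp_le[OF _ x0]) simp
      then show ?thesis using \<alpha> by (intro that[OF _ gauss_tail_shift_two_fifths_ge]) auto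
    qed
    have "prob {\<omega> \<in> space M. pval Z k \<omega> \<le> b} \<le> gauss_tail (x + d - m)"
      using b tail exp_x by (intro prob_pval_le[where Z = Z and k = k, OF Z]) linarith
    also have "\<dots> \<le> gauss_tail (- (y - d))" using m by (simp add: x_def y_eq)
    also have "\<dots> = Phi (y - d)" by (simp only: Phi_minus)
    also have "\<dots> \<le> \<delta> + \<alpha>" by (rule Phi_diff_le[OF d \<delta>y])
    finally show ?thesis using False by simp
  qed
qed

text \<open>Budget of the union bound: 1.9 \<open>\<alpha>\<close> for all levels together, plus at
  most \<open>\<delta> + \<alpha>\<close> for the late signals collected in
  \<open>T\<close>.\<close>

lemma power_bonferroni_sparse_less:
  assumes Z: "\<And>k. k \<ge> 1 \<Longrightarrow> distributed M lborel (Z k) (normal_density (\<mu> k) 1)"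
    and \<mu>: "\<And>k. k \<ge> 1 \<Longrightarrow> \<mu> k \<ge> 0"
    and \<alpha>: "0 < \<alpha>" and \<delta>: "\<alpha> \<le> \<delta>" "\<delta> + 3 * \<alpha> < 1"
    and a: "\<And>k. k \<ge> 1 \<Longrightarrow> a k \<ge> 0"
    and sums: "(\<lambda>k. a (Suc k)) sums \<alpha>"
    and mono: "\<And>i j. 1 \<le> i \<Longrightarrow> i \<le> j \<Longrightarrow> a j \<le> a i"
    and fin: "finite {k. 1 \<le> k \<and> \<mu> k > 0}" and card: "real (card {k. 1 \<le> k \<and> \<mu> k > 0}) \<le> N"
    and early: "\<And>k. k \<ge> 1 \<Longrightarrow> real k \<le> N\<^sup>2 / \<alpha> \<Longrightarrow> \<mu> k \<le> 0.4 * sqrt (a (nat \<lceil>N\<^sup>2 / \<alpha>\<rceil>))"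
    and late: "\<And>k. k \<ge> 1 \<Longrightarrow> \<mu> k > 0 \<Longrightarrow> real k > N\<^sup>2 / \<alpha> \<Longrightarrow>
      \<mu> k < sqrt (ln (real k / (4 * \<alpha>))) - sqrt (2 * ln (N / (2 * \<delta>)))"
  shows "power M (bonferroni_rejects a Z) < \<delta> + 3 * \<alpha>"
proof -
  define S where "S = {k. 1 \<le> k \<and> \<mu> k > 0}"
  define T where "T = {k \<in> S. real k > N\<^sup>2 / \<alpha>}"
  define t where "t = (if 2 * \<delta> \<le> N then \<delta> / N else \<delta> + \<alpha>)"
  define f where "f k = 19/10 * a k + (if k \<in> T then t else 0)" for k
  have S: "finite S" "real (card S) \<le> N" using fin card by (simp_all add: S_def)
  have T: "finite T" "card T \<le> card S" using S by (auto simp: T_def intro: card_mono)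
  have t0: "0 \<le> t" using \<alpha> \<delta> S by (auto simp: t_def)
  have cardT: "real (card T) * t \<le> \<delta> + \<alpha>"
  proof (cases "2 * \<delta> \<le> N")
    case True
    then have "real (card T) * t \<le> N * (\<delta> / N)"
      unfolding t_def using S T \<alpha> \<delta> by (intro mult_mono) auto
    then show ?thesis using True \<alpha> \<delta> by auto
  next
    case False
    \<comment> \<open>Here \<open>N < 2 * \<delta> < 2\<close>, so there is at most one late signal,
      and it may use the whole amount \<open>\<delta> + \<alpha>\<close>.\<close>
    then have "real (card T) < 2" using S T \<alpha> \<delta> by linarith
    then have "real (card T) \<le> 1" by simp
    then have "real (card T) * t \<le> 1 * t" using t0 by (rule mult_right_mono)
    then show ?thesis using False by (simp add: t_def)
  qed
  have "(\<lambda>k. if Suc k \<in> T then t else 0) sums (\<Sum>k\<in>{k. Suc k \<in> T}. t)"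
    using sums_If_finite_set[of "{k. Suc k \<in> T}" "\<lambda>_. t"] finite_vimageI[OF T(1), of Suc]
    by (simp add: vimage_def)
  moreover have "card {k. Suc k \<in> T} = card T"
  proof -
    have "T \<subseteq> range Suc"
    proof
      fix k assume "k \<in> T"
      then have "k = Suc (k - 1)" by (simp add: T_def S_def)
      then show "k \<in> range Suc" by (rule range_eqI)
    qed
    then show ?thesis using card_vimage_inj[of Suc T] by (simp add: vimage_def)
  qed
  ultimately have fsums: "(\<lambda>k. f (Suc k)) sums (19/10 * \<alpha> + real (card T) * t)"
    unfolding f_def by (intro sums_add sums_mult sums) simp
  have "power M (bonferroni_rejects a Z) \<le> 19/10 * \<alpha> + real (card T) * t"
  proof (rule power_bonferroni_le[OF _ _ fsums])
    fix k :: nat assume k: "1 \<le> k"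
    show "Z k \<in> borel_measurable M"
      using distributed_measurable[OF Z[OF k]] by simp
    show "prob {\<omega> \<in> space M. pval Z k \<omega> \<le> a k} \<le> f k"
    proof (cases "k \<in> T")
      case True
      then have kT: "\<mu> k > 0" "N\<^sup>2 / \<alpha> < real k" "k \<in> S" by (auto simp: T_def S_def)
      then have "0 < card S" using S by (auto simp: card_gt_0_iff)
      \<comment> \<open>The late signal \<open>k\<close> itself shows that the number of signals is
        at least one.\<close>
      then have N: "1 \<le> N" using S by linarith
      have "prob {\<omega> \<in> space M. pval Z k \<omega> \<le> a k} \<le> t"
        unfolding t_def using k kT
        by (intro prob_pval_le_late[where Z = Z and k = k, OF Z \<alpha> \<delta> N]
            le_div_of_nonincreasing_sums[OF a sums mono] late) auto
      then show ?thesis using True a[OF k] by (simp add: f_def)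
    next
      case False
      have "\<mu> k \<le> 2/5 * sqrt (a k)"
      proof (cases "\<mu> k > 0")
        case True
        then have le: "real k \<le> N\<^sup>2 / \<alpha>" using False k by (auto simp: T_def S_def)
        \<comment> \<open>The cutoff need not be an integer; rounding it up keeps it at or after
          \<open>k\<close>, so monotonicity of the levels applies.\<close>
        then have "k \<le> nat \<lceil>N\<^sup>2 / \<alpha>\<rceil>" by linarith
        then have "sqrt (a (nat \<lceil>N\<^sup>2 / \<alpha>\<rceil>)) \<le> sqrt (a k)"
          using k by (intro real_sqrt_le_mono mono)
        then show ?thesis using early[OF k le] by argo
      next
        case False
        then show ?thesis using a[OF k] by (auto intro: order_trans[of _ 0])
      qed
      moreover have "a k \<le> 1/4" using le_of_sums[OF a sums k] \<alpha> \<delta> by simp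
      ultimately have "prob {\<omega> \<in> space M. pval Z k \<omega> \<le> a k} \<le> 19/10 * a k"
        using a[OF k] \<mu>[OF k] by (intro prob_pval_le_small_mean[where Z = Z and k = k, OF Z[OF k]]) auto
      then show ?thesis using False by (simp add: f_def)
    qed
  qed
  also have "\<dots> < \<delta> + 3 * \<alpha>" using cardT \<alpha> by linarith
  finally show ?thesis .
qed

end

theorem theorem6:
  fixes P :: "'a measure" and Z :: "nat \<Rightarrow> 'a \<Rightarrow> real" and \<mu> :: "nat \<Rightarrow> real"
    and \<alpha> \<beta> :: real and a :: "nat \<Rightarrow> real"
  assumes "prob_space P"
    and "prob_space.indep_vars P (\<lambda>_. borel) Z {1..}"
    and "\<And>k. k \<ge> 1 \<Longrightarrow> distributed P lborel (Z k) (normal_density (\<mu> k) 1)"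
    and "\<And>k. k \<ge> 1 \<Longrightarrow> \<mu> k \<ge> 0"
    and "0 < \<alpha>" "\<alpha> < 1" "0 < \<beta>" "\<beta> < 1" "\<alpha> \<le> (1 - \<beta>) / 4"
    and "\<And>k. k \<ge> 1 \<Longrightarrow> a k \<ge> 0"
    and "(\<lambda>k. a (Suc k)) sums \<alpha>"
  shows
    "(infinite {k. 1 \<le> k \<and> \<mu> k > 0} \<longrightarrow>
        power P (bonferroni_rejects a Z) \<ge> 1 - \<beta> \<longrightarrow>
        (\<exists>k\<ge>1. rind \<mu> k * \<mu> k \<ge> 0.25 / sqrt (2 * ln (real k ^ 2 / \<alpha>))))
   \<and> (\<forall>M::real. finite {k. 1 \<le> k \<and> \<mu> k > 0} \<and> real (card {k. 1 \<le> k \<and> \<mu> k > 0}) \<le> M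
        \<and> (\<forall>i j. 1 \<le> i \<longrightarrow> i \<le> j \<longrightarrow> a j \<le> a i) \<longrightarrow>
        power P (bonferroni_rejects a Z) \<ge> 1 - \<beta> \<longrightarrow>
        (let kstar = M^2 / \<alpha> in
          \<exists>k\<ge>1. (real k \<le> kstar \<and> rind \<mu> k * \<mu> k \<ge> 0.4 * sqrt (a (nat \<lceil>kstar\<rceil>)))
               \<or> (real k > kstar \<and> rind \<mu> k * \<mu> k \<ge>
                    sqrt (ln (real k / (4 * \<alpha>))) - sqrt (2 * ln (M / (2 * (1 - \<beta> - 3 * \<alpha>)))))))
   \<and> ((\<exists>k\<ge>1. (\<Sum>i=1..k. \<mu> i * rind \<mu> i) \<ge> (Ck k \<alpha> + Ck k \<beta>) * sqrt (real k)) \<longrightarrow>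
        power P (stouffer_rejects \<alpha> Z) \<ge> 1 - \<beta>)"
proof -
  interpret prob_space P by fact
  \<comment> \<open>The means are nonnegative, so multiplying by the indicator changes
    nothing.\<close>
  have rind: "rind \<mu> k * \<mu> k = \<mu> k" if "k \<ge> 1" for k
    using assms(4)[OF that] by (auto simp: rind_def)
  have dense: "\<exists>k\<ge>1. rind \<mu> k * \<mu> k \<ge> 0.25 / sqrt (2 * ln (real k ^ 2 / \<alpha>))"
    if "power P (bonferroni_rejects a Z) \<ge> 1 - \<beta>"
  proof (rule ccontr)
    assume "\<not> ?thesis"
    then have "rind \<mu> k * \<mu> k < 0.25 / sqrt (2 * ln (real k ^ 2 / \<alpha>))" if "k \<ge> 1" for k
      using that not_le by blast
    then have "\<mu> k < 0.25 / sqrt (2 * ln (real k ^ 2 / \<alpha>))" if "k \<ge> 1" for k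
      using that by (metis rind)
    then have "power P (bonferroni_rejects a Z) < 4 * \<alpha>"
      using assms by (intro power_bonferroni_less[OF assms(3,4,5) _ assms(10,11)]) auto
    then show False using that assms(9) by simp
  qed
  have sparse: "\<exists>k\<ge>1. (real k \<le> N\<^sup>2 / \<alpha> \<and> rind \<mu> k * \<mu> k \<ge> 0.4 * sqrt (a (nat \<lceil>N\<^sup>2 / \<alpha>\<rceil>)))
      \<or> (real k > N\<^sup>2 / \<alpha> \<and> rind \<mu> k * \<mu> k \<ge>
          sqrt (ln (real k / (4 * \<alpha>))) - sqrt (2 * ln (N / (2 * (1 - \<beta> - 3 * \<alpha>)))))"
    if N: "finite {k. 1 \<le> k \<and> \<mu> k > 0}" "real (card {k. 1 \<le> k \<and> \<mu> k > 0}) \<le> N"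
        "\<forall>i j. 1 \<le> i \<longrightarrow> i \<le> j \<longrightarrow> a j \<le> a i"
      and pow: "power P (bonferroni_rejects a Z) \<ge> 1 - \<beta>" for N :: real
  proof (rule ccontr)
    assume neg: "\<not> ?thesis"
    \<comment> \<open>Here \<open>\<delta>\<close> is \<open>1 - \<beta> - 3 * \<alpha>\<close>; it
      is at least \<open>\<alpha>\<close> because
      \<open>\<alpha> \<le> (1 - \<beta>) / 4\<close>.\<close>
    have "power P (bonferroni_rejects a Z) < (1 - \<beta> - 3 * \<alpha>) + 3 * \<alpha>"
    proof (rule power_bonferroni_sparse_less[OF assms(3,4) _ _ _ assms(10,11) _ N(1,2)])
      fix k :: nat assume k: "1 \<le> k"
      show "\<mu> k \<le> 0.4 * sqrt (a (nat \<lceil>N\<^sup>2 / \<alpha>\<rceil>))" if "real k \<le> N\<^sup>2 / \<alpha>"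
        using neg that k by (metis rind nle_le)
      show "\<mu> k < sqrt (ln (real k / (4 * \<alpha>))) - sqrt (2 * ln (N / (2 * (1 - \<beta> - 3 * \<alpha>))))"
        if "real k > N\<^sup>2 / \<alpha>"
        using neg that k by (metis rind not_le)
    qed (use assms N(3) in auto)
    then show False using pow by simp
  qed
  have stouffer: "power P (stouffer_rejects \<alpha> Z) \<ge> 1 - \<beta>"
    if k: "k \<ge> 1" "(\<Sum>i=1..k. \<mu> i * rind \<mu> i) \<ge> (Ck k \<alpha> + Ck k \<beta>) * sqrt (real k)" for k
  proof (rule power_stouffer_ge[OF assms(2,3,7,8) k(1)])
    have "(\<Sum>i=1..k. \<mu> i * rind \<mu> i) = (\<Sum>i=1..k. \<mu> i)"
      using rind by (intro sum.cong) (auto simp: mult.commute)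
    then show "(Ck k \<alpha> + Ck k \<beta>) * sqrt (real k) \<le> (\<Sum>i=1..k. \<mu> i)" using k(2) by simp
  qed
  show ?thesis
    using dense sparse stouffer unfolding Let_def by blast
qed

end
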